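(* Let $G$ be a nontrivial cyclic group of order $n$, let $S$ be the set of all generators of $G$, and let $\Gamma(G)$ be the generator graph of $G$. Then the Randić index of $\Gamma(G)$ is $$R(\Gamma(G)) = \frac{1}{n-1}\left(\tfrac{1}{2}|S|(|S|-1) + (n-|S|)\sqrt{(n-1)|S|}\right).$$
   Context: For a group $G$, the generator graph $\Gamma(G)$ is the simple undirected graph whose vertex set is the set of elements of $G$, in which two distinct elements $x,y$ are adjacent if and only if at least one of them generates $G$ (i.e. $\langle x\rangle = G$ or $\langle y\rangle = G$). For a graph $\Gamma$, the Randić index is $R(\Gamma) = \sum_{uv\in E(\Gamma)} \frac{1}{\sqrt{\deg_\Gamma(u)\deg_\Gamma(v)}}$. *)

theory Defs
  imports Complex_Main "HOL-Algebra.Elementary_Groups" "Graph_Theory.Pair_Digraph"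
begin

definition group_generators :: "('a, 'b) monoid_scheme \<Rightarrow> 'a set" where
  "group_generators G = {x \<in> carrier G. generate G {x} = carrier G}"

text \<open>
  A simple undirected graph is a \<open>pair_graph\<close>: a symmetric, loop-free digraph in which the
  arcs \<open>(u, v)\<close> and \<open>(v, u)\<close> together represent the edge between \<open>u\<close> and \<open>v\<close>.
\<close>

definition generator_graph :: "('a, 'b) monoid_scheme \<Rightarrow> 'a pair_pre_digraph" where
  "generator_graph G = \<lparr> pverts = carrier G,
     parcs = {(x, y). x \<in> carrier G \<and> y \<in> carrier G \<and> x \<noteq> y \<and>
                (x \<in> group_generators G \<or> y \<in> group_generators G)} \<rparr>"

lemma pair_graph_generator_graph:
  assumes "finite (carrier G)"
  shows "pair_graph (generator_graph G)"
proof -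
  have "finite (parcs (generator_graph G))"
    by (rule finite_subset[of _ "carrier G \<times> carrier G"])
      (use assms in \<open>auto simp: generator_graph_def\<close>)
  with assms show ?thesis
    by unfold_locales (auto simp: generator_graph_def symmetric_def intro: symI)
qed

definition undirected_edges :: "'a pair_pre_digraph \<Rightarrow> 'a set set" where
  "undirected_edges \<Gamma> = {{u, v} | u v. (u, v) \<in> parcs \<Gamma>}"

text \<open>
  In a symmetric digraph the out-degree of a vertex is its number of neighbours. The product
  below is over the two endpoints of the edge, see \<open>prod_degrees_edge\<close>.
\<close>

definition randic_index :: "'a pair_pre_digraph \<Rightarrow> real" where
  "randic_index \<Gamma> =
     (\<Sum>e\<in>undirected_edges \<Gamma>. 1 / sqrt (\<Prod>w\<in>e. real (out_degree (with_proj \<Gamma>) w)))"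

lemma (in pair_graph) prod_degrees_edge:
  assumes "(u, v) \<in> parcs G"
  shows "(\<Prod>w\<in>{u, v}. real (out_degree (with_proj G) w)) =
    real (out_degree (with_proj G) u) * real (out_degree (with_proj G) v)"
  using pair_no_loops[OF assms] by simp

end

theory Submission
  imports Defs
begin

text \<open>A generator is adjacent to every other element, so it has degree n - 1; a non-generator
  is adjacent exactly to the generators, so it has degree s = |S|
  (\<open>out_degree_generator\<close>, \<open>out_degree_nongenerator\<close>). Every edge has an
  endpoint in S. By \<open>undirected_edges_generator_graph\<close> the edges therefore fall into
  s(s-1)/2 pairs inside S, each of weight 1/(n-1), and s(n-s) pairs joining S to its complement,
  each of weight 1/sqrt((n-1)s). Adding the two constant sums gives the formula.\<close>

lemma out_degree_generator_graph:
  "out_degree (with_proj (generator_graph G)) x = card {y. (x, y) \<in> parcs (generator_graph G)}"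
proof -
  have "out_arcs (with_proj (generator_graph G)) x
      = Pair x ` {y. (x, y) \<in> parcs (generator_graph G)}"
    by (auto simp: out_arcs_def)
  then show ?thesis
    by (simp add: out_degree_def card_image inj_on_def)
qed

lemma group_generators_subset: "group_generators G \<subseteq> carrier G"
  by (auto simp: group_generators_def)

text \<open>Only x itself is missing from the neighbours of x. For an infinite carrier both sides
  are 0, since \<open>card\<close> is then 0 and subtraction truncates.\<close>

lemma out_degree_generator:
  assumes "x \<in> group_generators G"
  shows "out_degree (with_proj (generator_graph G)) x = order G - 1"
proof -
  have "{y. (x, y) \<in> parcs (generator_graph G)} = carrier G - {x}"
    using assms group_generators_subset[of G] by (auto simp: generator_graph_def)
  then show ?thesis
    using assms group_generators_subset[of G]
    by (auto simp: out_degree_generator_graph order_def)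
qed

lemma out_degree_nongenerator:
  assumes "x \<in> carrier G - group_generators G"
  shows "out_degree (with_proj (generator_graph G)) x = card (group_generators G)"
proof -
  have "{y. (x, y) \<in> parcs (generator_graph G)} = group_generators G"
    using assms group_generators_subset[of G] by (auto simp: generator_graph_def)
  then show ?thesis
    by (simp add: out_degree_generator_graph)
qed

text \<open>Mixed edges are written as images of ordered pairs with the generator first, so that
  they can be counted as a Cartesian product.\<close>

lemma undirected_edges_generator_graph:
  fixes G (structure)
  defines "S \<equiv> group_generators G"
  shows "undirected_edges (generator_graph G)
    = {e. e \<subseteq> S \<and> card e = 2} \<union> (\<lambda>(u, v). {u, v}) ` (S \<times> (carrier G - S))"
    (is "?E = ?A \<union> ?B")
proof (intro equalityI subsetI)
  fix e assume "e \<in> ?E"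
  then obtain u v where e: "e = {u, v}" and uv: "(u, v) \<in> parcs (generator_graph G)"
    by (auto simp: undirected_edges_def)
  from uv have *: "u \<noteq> v" "u \<in> carrier G" "v \<in> carrier G" "u \<in> S \<or> v \<in> S"
    by (auto simp: generator_graph_def S_def)
  consider "u \<in> S" "v \<in> S" | "u \<in> S" "v \<notin> S" | "u \<notin> S" "v \<in> S"
    using * by blast
  then show "e \<in> ?A \<union> ?B"
  proof cases
    case 1
    with * e show ?thesis by simp
  next
    case 2
    with * e show ?thesis by (intro UnI2 image_eqI[of _ _ "(u, v)"]) auto
  next
    case 3
    with * e show ?thesis by (intro UnI2 image_eqI[of _ _ "(v, u)"]) auto
  qed
next
  fix e assume "e \<in> ?A \<union> ?B"
  then obtain u v where "e = {u, v}" "u \<noteq> v" "u \<in> S" "v \<in> carrier G"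
    using group_generators_subset[of G] by (fastforce simp: card_2_iff S_def)
  then show "e \<in> ?E"
    using group_generators_subset[of G]
    by (auto simp: undirected_edges_def generator_graph_def S_def)
qed

theorem theorem4p7:
  fixes G :: "('a, 'b) monoid_scheme" and n :: nat and S :: "'a set"
  assumes "group G" and "cyclic_group G" and "\<not> trivial_group G"
    and "finite (carrier G)" and "order G = n"
    and "S = group_generators G"
  shows "randic_index (generator_graph G) =
    1 / (real n - 1) *
      (1 / 2 * real (card S) * (real (card S) - 1)
        + (real n - real (card S)) * sqrt ((real n - 1) * real (card S)))"
proof -
  define s where "s = card S"
  define w where
    "w e = 1 / sqrt (\<Prod>x\<in>e. real (out_degree (with_proj (generator_graph G)) x))" for e
  let ?A = "{e. e \<subseteq> S \<and> card e = 2}"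
  let ?B = "S \<times> (carrier G - S)" and ?f = "\<lambda>(u, v). {u, v}"
  have SC: "S \<subseteq> carrier G"
    using assms(6) group_generators_subset by simp
  have finS: "finite S"
    using SC assms(4) finite_subset by blast
  have "n > 0"
    using assms(1,4,5) group.is_monoid monoid.one_closed by (fastforce simp: order_def card_gt_0_iff)
  \<comment> \<open>Degrees use truncated subtraction on naturals; positivity of n makes the cast
    exact.\<close>
  then have n1: "real (n - 1) = real n - 1"
    by (simp add: of_nat_diff)
  have deg_S: "out_degree (with_proj (generator_graph G)) x = n - 1" if "x \<in> S" for x
    using that assms(5,6) by (simp add: out_degree_generator)
  have deg_C: "out_degree (with_proj (generator_graph G)) x = s" if "x \<in> carrier G - S" for x
    using that assms(6) by (simp add: out_degree_nongenerator s_def)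
  \<comment> \<open>The product over the two endpoints is (n-1)^2, whose root is n - 1 because n - 1
    is nonnegative.\<close>
  have "w e = 1 / (real n - 1)" if "e \<in> ?A" for e
  proof -
    have "(\<Prod>x\<in>e. real (out_degree (with_proj (generator_graph G)) x)) = (\<Prod>x\<in>e. real n - 1)"
      using that deg_S n1 by (intro prod.cong) auto
    then show ?thesis
      using that \<open>n > 0\<close> by (simp add: w_def)
  qed
  then have "sum w ?A = real (card ?A) * (1 / (real n - 1))"
    by simp
  \<comment> \<open>Splitting on s removes the truncated s - 1 from the binomial
    coefficient.\<close>
  also have "real (card ?A) = real s * (real s - 1) / 2"
    using n_subsets[OF finS, of 2] by (cases s) (simp_all add: s_def choose_two real_of_nat_div algebra_simps)
  finally have sumA: "sum w ?A = real s * (real s - 1) / 2 * (1 / (real n - 1))" .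
  \<comment> \<open>The endpoint lying in S determines the order of the pair.\<close>
  have inj: "inj_on ?f ?B"
    by (auto simp: inj_on_def doubleton_eq_iff)
  have "(w \<circ> ?f) p = 1 / sqrt ((real n - 1) * real s)" if "p \<in> ?B" for p
    using that deg_S deg_C n1 by (cases p, cases "fst p = snd p") (auto simp: w_def)
  then have "sum w (?f ` ?B) = real (card ?B) * (1 / sqrt ((real n - 1) * real s))"
    using sum.reindex[OF inj, of w] by simp
  also have "real (card ?B) = real s * (real n - real s)"
    using SC finS assms(4,5) card_mono[OF assms(4) SC]
    by (simp add: card_cartesian_product card_Diff_subset s_def order_def of_nat_diff)
  \<comment> \<open>The grouping prepares s / sqrt s = sqrt s, which also holds at s = 0 as division
    by 0 gives 0.\<close>
  also have "real s * (real n - real s) * (1 / sqrt ((real n - 1) * real s))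
      = (real n - real s) * (real s / sqrt (real s)) * (1 / sqrt (real n - 1))"
    by (simp add: real_sqrt_mult mult_ac)
  also have "1 / sqrt (real n - 1) = sqrt (real n - 1) / (real n - 1)"
    using \<open>n > 0\<close> by (simp add: sqrt_divide_self_eq inverse_eq_divide)
  finally have sumB: "sum w (?f ` ?B)
      = (real n - real s) * sqrt ((real n - 1) * real s) / (real n - 1)"
    by (simp add: real_div_sqrt real_sqrt_mult mult_ac)
  have "finite ?A"
    using finS by (intro finite_subset[of ?A "Pow S"]) auto
  \<comment> \<open>The two families are disjoint: a mixed edge has an endpoint outside S.\<close>
  then have "randic_index (generator_graph G) = sum w ?A + sum w (?f ` ?B)"
    unfolding randic_index_def undirected_edges_generator_graph assms(6)[symmetric] w_def[symmetric]
    using finS assms(4) by (intro sum.union_disjoint) auto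
  then show ?thesis
    unfolding sumA sumB s_def by (simp add: algebra_simps add_divide_distrib diff_divide_distrib)
qed

end
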